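(* Let $n>1$ and let $$D^{n,1}=\{(z_0,\dots,z_n)\in\mathbb{C}^{n+1}: -|z_0|^2+|z_1|^2+\cdots+|z_n|^2>0\}.$$ Then the group $\mathrm{Aut}(D^{n,1})$ of all biholomorphic self-maps of $D^{n,1}$ equals $GU(n,1)$, acting on $D^{n,1}$ by linear transformations $z\mapsto Az$.
   Context: $GU(n,1)=\{A\in GL(n+1,\mathbb{C}): A^*JA=\nu(A)J \text{ for some } \nu(A)\in\mathbb{R}_{>0}\}$, where $J=\mathrm{diag}(-1,1,\dots,1)$ (i.e. $J=\begin{pmatrix}-1&0\\0&E_n\end{pmatrix}$ with $E_n$ the $n\times n$ identity). *)

theory Defs
  imports "HOL-Analysis.Analysis"
begin

text \<open>Coordinates of C^(n+1) are indexed by 'n option: None is the coordinate z_0,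
  Some i (i :: 'n) are z_1..z_n, so n = CARD('n).\<close>

definition herm_form :: "complex ^ ('n::finite option) \<Rightarrow> real" where
  "herm_form z = - (cmod (z $ None))\<^sup>2 + (\<Sum>i\<in>UNIV. (cmod (z $ Some i))\<^sup>2)"

definition Dn1 :: "(complex ^ ('n::finite option)) set" where
  "Dn1 = {z. herm_form z > 0}"

definition Jmat :: "complex ^ ('n::finite option) ^ ('n option)" where
  "Jmat = (\<chi> i j. if i = j then (if i = None then -1 else 1) else 0)"

definition conj_transpose :: "complex ^ 'm ^ 'n \<Rightarrow> complex ^ 'n ^ 'm" where
  "conj_transpose A = (\<chi> i j. cnj (A $ j $ i))"

definition GU :: "(complex ^ ('n::finite option) ^ ('n option)) set" where
  "GU = {A. invertible A \<and>
           (\<exists>\<nu>::real. \<nu> > 0 \<and> conj_transpose A ** Jmat ** A = (\<chi> i j. complex_of_real \<nu> * Jmat $ i $ j))}"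

definition holo_on :: "(complex ^ 'a \<Rightarrow> complex ^ 'b) \<Rightarrow> (complex ^ 'a) set \<Rightarrow> bool" where
  "holo_on f U \<longleftrightarrow> (\<forall>z\<in>U. \<exists>L. (f has_derivative L) (at z) \<and> (\<forall>c x. L (c *s x) = c *s L x))"

definition biholo_self :: "(complex ^ 'a \<Rightarrow> complex ^ 'a) \<Rightarrow> (complex ^ 'a) set \<Rightarrow> bool" where
  "biholo_self f U \<longleftrightarrow> holo_on f U \<and> f ` U \<subseteq> U \<and>
     (\<exists>g. holo_on g U \<and> g ` U \<subseteq> U \<and> (\<forall>z\<in>U. g (f z) = z \<and> f (g z) = z))"

end

theory Submission
  imports Defs "HOL-Complex_Analysis.Conformal_Mappings"
begin

text \<open>
  For fixed \<open>z_0\<close> the slice of the domain is the complement of a closed ball in \<open>C^n\<close> with \<open>n > 1\<close>, so by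
  Hartogs' phenomenon an automorphism \<open>f\<close> and its inverse extend to maps \<open>F\<close>, \<open>G\<close> of \<open>C^(n+1)\<close>, which
  remain mutually inverse by the identity theorem. Hence \<open>F\<close> preserves the complement of the domain, where
  \<open>|z_i| \<le> |z_0|\<close>. On a line through the origin in this complement Liouville's theorem makes all
  \<open>F_i / F_0\<close> constant, so \<open>F\<close> maps the line injectively into a line; therefore \<open>F\<close> fixes the origin and
  is homogeneous of degree one, first on the complement and then everywhere. A homogeneous entire map
  grows linearly along every line, so it is linear. A linear map preserving the positive cone of the
  form also preserves its null cone, and this forces it to be a similitude.
\<close>

subsection \<open>Entire functions of one variable\<close>

text \<open>Morera's theorem: a triangle integral in \<open>t\<close> can be exchanged with the
  circle integral in \<open>u\<close>, and Cauchy's theorem makes the inner triangle integral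
  vanish.\<close>

lemma contour_integral_circlepath_param_holomorphic:
  fixes \<phi> :: "complex \<Rightarrow> complex \<Rightarrow> complex"
  assumes "open S" and "R > 0"
    and cont: "continuous_on (S \<times> sphere 0 R) (\<lambda>(t, u). \<phi> t u)"
    and holo: "\<And>u. u \<in> sphere 0 R \<Longrightarrow> (\<lambda>t. \<phi> t u) holomorphic_on S"
  shows "(\<lambda>t. contour_integral (circlepath 0 R) (\<phi> t)) holomorphic_on S"
proof -
  let ?\<gamma> = "circlepath 0 R"
  have im: "path_image ?\<gamma> = sphere 0 R"
    using \<open>R > 0\<close> by simp
  have \<gamma>_in: "?\<gamma> x \<in> sphere 0 R" if "x \<in> {0..1}" for x
    using im that by (auto simp: path_image_def)
  have vd: "vector_derivative ?\<gamma> (at x) = 2 * of_real pi * \<i> * of_real R * exp (2 * of_real pi * \<i> * of_real x)" for x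
    by (simp add: vector_derivative_circlepath)
  have cvd: "continuous_on {0..1} (\<lambda>x. vector_derivative ?\<gamma> (at x))"
    unfolding vd by (intro continuous_intros)
  have c\<gamma>: "continuous_on {0..1} ?\<gamma>"
    using path_circlepath path_def by blast
  have "continuous_on (S \<times> cbox 0 1) (\<lambda>(t, x). \<phi> t (?\<gamma> x) * vector_derivative ?\<gamma> (at x))"
  proof -
    have "continuous_on (S \<times> cbox 0 1) (\<lambda>p. (\<lambda>(t, u). \<phi> t u) (fst p, ?\<gamma> (snd p)))"
      by (rule continuous_on_compose2[OF cont])
         (use \<gamma>_in in \<open>auto intro!: continuous_intros continuous_on_compose2[OF c\<gamma>]\<close>)
    moreover have "continuous_on (S \<times> cbox 0 1) (\<lambda>p. vector_derivative ?\<gamma> (at (snd p)))"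
      by (rule continuous_on_compose2[OF cvd]) (auto intro!: continuous_intros)
    ultimately show ?thesis
      by (auto simp: case_prod_unfold intro: continuous_on_mult)
  qed
  from integral_continuous_on_param[OF this]
  have contI: "continuous_on S (\<lambda>t. contour_integral ?\<gamma> (\<phi> t))"
    by (simp add: contour_integral_integral cbox_interval)
  have swap: "contour_integral (linepath a b) (\<lambda>t. contour_integral ?\<gamma> (\<phi> t))
      = contour_integral ?\<gamma> (\<lambda>u. contour_integral (linepath a b) (\<lambda>t. \<phi> t u))"
    if "closed_segment a b \<subseteq> S" for a b
  proof (rule contour_integral_swap)
    show "continuous_on (path_image (linepath a b) \<times> path_image ?\<gamma>) (\<lambda>(t, u). \<phi> t u)"
      using that im by (intro continuous_on_subset[OF cont]) auto
  qed (use cvd in auto)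
  \<comment> \<open>Allows the three circle integrals to be merged into one; a segment integral
    depends continuously on \<open>u\<close>.\<close>
  have inner: "(\<lambda>u. contour_integral (linepath a b) (\<lambda>t. \<phi> t u)) contour_integrable_on ?\<gamma>"
    if ab: "closed_segment a b \<subseteq> S" for a b
  proof -
    have "continuous_on (sphere 0 R \<times> cbox 0 1) (\<lambda>(u, x). \<phi> (linepath a b x) u * (b - a))"
    proof -
      have lp: "linepath a b x \<in> S" if "x \<in> cbox 0 1" for x
        using ab that by (auto simp: path_image_linepath[symmetric] path_image_def)
      have "continuous_on (sphere 0 R \<times> cbox 0 1) (\<lambda>p. (\<lambda>(t, u). \<phi> t u) (linepath a b (snd p), fst p))"
        by (rule continuous_on_compose2[OF cont])
           (use lp in \<open>auto intro!: continuous_intros continuous_on_compose2[OF continuous_on_linepath]\<close>)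
      then show ?thesis
        by (auto simp: case_prod_unfold intro!: continuous_intros)
    qed
    from integral_continuous_on_param[OF this]
    have "continuous_on (sphere 0 R) (\<lambda>u. contour_integral (linepath a b) (\<lambda>t. \<phi> t u))"
      by (simp add: contour_integral_integral cbox_interval)
    then show ?thesis
      by (intro contour_integrable_continuous_circlepath) (use \<open>R > 0\<close> in simp)
  qed
  have "(\<lambda>t. contour_integral ?\<gamma> (\<phi> t)) analytic_on S"
  proof (intro Morera_triangle[OF contI \<open>open S\<close>] impI)
    fix a b c assume abc: "convex hull {a, b, c} \<subseteq> S"
    have "closed_segment x y \<subseteq> convex hull {a, b, c}" if "x \<in> {a, b, c}" "y \<in> {a, b, c}" for x y
      using that by (intro closed_segment_subset hull_inc convex_convex_hull)
    with abc have seg: "closed_segment a b \<subseteq> S" "closed_segment b c \<subseteq> S" "closed_segment c a \<subseteq> S"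
      by (meson insertCI order_trans)+
    have zero: "contour_integral (linepath a b) (\<lambda>t. \<phi> t u) + contour_integral (linepath b c) (\<lambda>t. \<phi> t u)
        + contour_integral (linepath c a) (\<lambda>t. \<phi> t u) = 0" if "u \<in> sphere 0 R" for u
    proof -
      have h: "(\<lambda>t. \<phi> t u) holomorphic_on convex hull {a, b, c}"
        using holo[OF that] abc holomorphic_on_subset by blast
      have cs: "continuous_on (closed_segment x y) (\<lambda>t. \<phi> t u)" if "closed_segment x y \<subseteq> S" for x y
        using holo[OF \<open>u \<in> _\<close>] that continuous_on_subset holomorphic_on_imp_continuous_on by blast
      show ?thesis
        using contour_integral_unique[OF Cauchy_theorem_triangle[OF h]]
          cs[OF seg(1)] cs[OF seg(2)] cs[OF seg(3)]
        by (simp add: contour_integrable_continuous_linepath add.assoc)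
    qed
    show "contour_integral (linepath a b) (\<lambda>t. contour_integral ?\<gamma> (\<phi> t))
        + contour_integral (linepath b c) (\<lambda>t. contour_integral ?\<gamma> (\<phi> t))
        + contour_integral (linepath c a) (\<lambda>t. contour_integral ?\<gamma> (\<phi> t)) = 0"
    proof -
      let ?I = "\<lambda>a b u. contour_integral (linepath a b) (\<lambda>t. \<phi> t u)"
      have "contour_integral ?\<gamma> (?I a b) + contour_integral ?\<gamma> (?I b c) + contour_integral ?\<gamma> (?I c a)
          = contour_integral ?\<gamma> (\<lambda>u. ?I a b u + ?I b c u + ?I c a u)"
        by (simp add: contour_integral_add contour_integrable_add inner seg)
      also have "\<dots> = contour_integral ?\<gamma> (\<lambda>u. 0)"
        by (rule contour_integral_eq) (use zero im in metis)
      finally show ?thesis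
        using swap seg by simp
    qed
  qed
  then show ?thesis
    using analytic_imp_holomorphic by blast
qed

text \<open>The exterior of a disc is open and nonempty, so the identity theorem applies. Below,
  this carries identities from the far part of a complex line to the whole line.\<close>

lemma entire_eq_if_eq_outside_disc:
  fixes p q :: "complex \<Rightarrow> complex"
  assumes "p holomorphic_on UNIV" "q holomorphic_on UNIV"
    and "\<And>t. cmod t > B \<Longrightarrow> p t = q t"
  shows "p t = q t"
proof (rule analytic_continuation_open[of "- cball 0 \<bar>B\<bar>" UNIV p q])
  have "of_real (\<bar>B\<bar> + 1) \<in> - cball (0::complex) \<bar>B\<bar>"
    by (simp del: of_real_add)
  then show "- cball (0::complex) \<bar>B\<bar> \<noteq> {}" by blast
qed (use assms in auto)

text \<open>The quotient \<open>k t = p t / t\<close>, completed at 0 by the derivative, has no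
  zero, and \<open>p\<close> stays away from 0 outside the unit disc. Hence \<open>1 / k\<close>
  grows at most linearly, is an affine polynomial without roots, and must be constant.\<close>

lemma entire_injective_linear:
  fixes p :: "complex \<Rightarrow> complex"
  assumes holp: "p holomorphic_on UNIV" and inj: "inj p" and p0: "p 0 = 0"
  obtains a where "\<And>t. p t = a * t"
proof -
  define k where "k t = (if t = 0 then deriv p 0 else (p t - p 0) / (t - 0))" for t
  have holk: "k holomorphic_on UNIV"
    unfolding k_def by (rule pole_lemma_open[OF holp open_UNIV])
  have k_eq: "p t = k t * t" for t
    by (auto simp: k_def p0)
  have k_nz: "k t \<noteq> 0" for t
  proof (cases "t = 0")
    case True
    then show ?thesis
      using holomorphic_injective_imp_regular[OF holp _ inj] by (simp add: k_def)
  next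
    case False
    then have "p t \<noteq> p 0" using inj by (metis injD)
    then show ?thesis using p0 False by (simp add: k_def)
  qed
  \<comment> \<open>The open image of the unit disc contains a ball about 0; by injectivity no
    \<open>t\<close> with \<open>|t| >= 1\<close> is mapped into that ball.\<close>
  have "open (p ` ball 0 1)"
    using holp inj by (intro open_mapping_thm3) (auto intro: holomorphic_on_subset inj_on_subset)
  moreover have "0 \<in> p ` ball 0 1"
    using p0 by force
  ultimately obtain r where r: "r > 0" "ball 0 r \<subseteq> p ` ball 0 1"
    by (meson openE)
  have p_ge: "cmod (p t) \<ge> r" if "cmod t \<ge> 1" for t
  proof (rule ccontr)
    assume "\<not> cmod (p t) \<ge> r"
    then have "p t \<in> p ` ball 0 1" using r by auto
    then obtain s where "s \<in> ball 0 1" "p t = p s" by blast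
    then show False using injD[OF inj, of t s] that by simp
  qed
  let ?q = "\<lambda>t. inverse (k t)"
  have holq: "?q holomorphic_on UNIV"
    using holk k_nz by (intro holomorphic_intros) auto
  have bound: "cmod (?q t) \<le> (1 / r) * cmod t ^ 1" if "1 \<le> cmod t" for t
  proof -
    have "r \<le> cmod (k t) * cmod t"
      using p_ge[OF that] k_eq[of t] by (simp add: norm_mult)
    then show ?thesis
      using k_nz[of t] r by (simp add: norm_inverse norm_divide field_simps)
  qed
  define b where "b = deriv ?q 0"
  have q_eq: "?q t = ?q 0 + b * t" for t
    using Liouville_polynomial[OF holq bound, where \<xi> = t] by (simp add: b_def)
  have "b = 0"
  proof (rule ccontr)
    assume "b \<noteq> 0"
    then have "?q (- ?q 0 / b) = 0" by (subst q_eq) simp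
    then show False using k_nz by simp
  qed
  then have "k t = k 0" for t
    using q_eq[of t] by simp
  then show ?thesis
    using k_eq that by metis
qed

text \<open>Away from \<open>s\<close> the quotient \<open>q / p\<close> is holomorphic and bounded
  by 1, so the singularity is removable and Liouville's theorem makes the extension
  constant.\<close>

lemma entire_dominated_proportional:
  fixes p q :: "complex \<Rightarrow> complex"
  assumes holp: "p holomorphic_on UNIV" and holq: "q holomorphic_on UNIV"
    and le: "\<And>t. cmod (q t) \<le> cmod (p t)"
    and zero: "\<And>t. p t = 0 \<Longrightarrow> t = s"
  obtains c where "\<And>t. q t = c * p t"
proof -
  have "(\<lambda>t. q t / p t) holomorphic_on UNIV - {s}"
    using assms by (intro holomorphic_intros holomorphic_on_subset[OF holq] holomorphic_on_subset[OF holp]) auto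
  \<comment> \<open>Where \<open>p t = 0\<close> the quotient is 0 by the convention for division,
    so the bound holds at every \<open>t\<close>.\<close>
  moreover have le1: "cmod (q t / p t) \<le> 1" for t
    using le[of t] by (cases "p t = 0") (auto simp: norm_divide)
  then have "eventually (\<lambda>t. cmod (q t / p t) \<le> 1) (at s)"
    by simp
  ultimately obtain h where h: "h holomorphic_on UNIV" "\<And>t. t \<noteq> s \<Longrightarrow> h t = q t / p t"
    using holomorphic_on_extend_bounded[of "\<lambda>t. q t / p t" UNIV s] by (auto simp del: norm_divide)
  have hp: "q t = h t * p t" if "t \<noteq> s" for t
    using h(2)[OF that] zero that by auto
  have hp': "q t = h t * p t" for t
    by (rule entire_eq_if_eq_outside_disc[of _ "\<lambda>t. h t * p t" "cmod s"])
       (use hp in \<open>(force intro!: holomorphic_intros h holp holq)+\<close>)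
  have "bounded (range h)"
  proof -
    \<comment> \<open>The value \<open>h s\<close> is not given by the quotient, so it is added to
      the bounded set separately.\<close>
    have "h t \<in> insert (h s) (cball 0 1)" for t
      using h(2)[of t] le1[of t] by (cases "t = s") auto
    then have "range h \<subseteq> insert (h s) (cball 0 1)" by blast
    moreover have "bounded (insert (h s) (cball 0 1))" by simp
    ultimately show ?thesis using bounded_subset by blast
  qed
  then obtain c where "\<And>t. h t = c"
    using Liouville_theorem[OF h(1)] by (auto simp: constant_on_def)
  with hp' have "q t = c * p t" for t by simp
  then show ?thesis by (rule that)
qed

subsection \<open>Extension across the complement\<close>

lemma has_derivative_vecI:
  fixes f :: "'a::real_normed_vector \<Rightarrow> 'b::euclidean_space ^ 'm"
  assumes "\<And>i. ((\<lambda>x. f x $ i) has_derivative (\<lambda>h. f' h $ i)) (at a within S)"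
  shows "(f has_derivative f') (at a within S)"
proof (rule iffD2[OF has_derivative_componentwise_within], rule ballI)
  fix b :: "'b ^ 'm" assume "b \<in> Basis"
  then obtain i c where b: "b = axis i c"
    by (auto simp: Basis_vec_def)
  show "((\<lambda>x. f x \<bullet> b) has_derivative (\<lambda>h. f' h \<bullet> b)) (at a within S)"
    unfolding b inner_axis by (rule has_derivative_inner_left[OF assms])
qed

text \<open>Holomorphy is only ever used along holomorphic curves. This notion is stable under the
  Cauchy-integral extension below and under composition, so differentiability
  in several variables of the extension never has to be established.\<close>

definition holo_along_curves :: "(complex ^ 'a \<Rightarrow> complex) \<Rightarrow> (complex ^ 'a) set \<Rightarrow> bool" where
  "holo_along_curves h U \<longleftrightarrow>
     (\<forall>S \<gamma>. open S \<longrightarrow> (\<forall>j. (\<lambda>t. \<gamma> t $ j) holomorphic_on S) \<longrightarrow> \<gamma> ` S \<subseteq> U \<longrightarrow>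
        (\<lambda>t. h (\<gamma> t)) holomorphic_on S)"

lemma holo_along_curvesD:
  assumes "holo_along_curves h U" "open S" "\<And>j. (\<lambda>t. \<gamma> t $ j) holomorphic_on S"
    and "\<And>t. t \<in> S \<Longrightarrow> \<gamma> t \<in> U"
  shows "(\<lambda>t. h (\<gamma> t)) holomorphic_on S"
proof -
  have "\<gamma> ` S \<subseteq> U" using assms(4) by (rule image_subsetI)
  then show ?thesis using assms(1-3) unfolding holo_along_curves_def by simp
qed

lemma holo_on_imp_continuous_on:
  "holo_on f U \<Longrightarrow> continuous_on U f"
  unfolding holo_on_def
  by (intro continuous_at_imp_continuous_on ballI) (blast dest: has_derivative_continuous)

text \<open>Chain rule: complex homogeneity of the derivative \<open>L\<close> turns the real
  derivative along a curve into multiplication by a complex number.\<close>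

lemma holo_on_imp_holo_along_curves:
  fixes f :: "complex ^ 'a \<Rightarrow> complex ^ 'b"
  assumes "holo_on f U"
  shows "holo_along_curves (\<lambda>z. f z $ k) U"
  unfolding holo_along_curves_def
proof (intro allI impI)
  fix S and \<gamma> :: "complex \<Rightarrow> complex ^ 'a"
  assume "open S" and hol: "\<forall>j. (\<lambda>t. \<gamma> t $ j) holomorphic_on S" and sub: "\<gamma> ` S \<subseteq> U"
  have "\<exists>d. ((\<lambda>t. f (\<gamma> t) $ k) has_field_derivative d) (at t)" if t: "t \<in> S" for t
  proof -
    have "\<exists>d. ((\<lambda>t. \<gamma> t $ j) has_field_derivative d) (at t)" for j
      using hol t by (simp add: holomorphic_on_open[OF \<open>open S\<close>])
    then obtain d where d: "\<And>j. ((\<lambda>t. \<gamma> t $ j) has_field_derivative d j) (at t)"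
      by metis
    have \<gamma>: "(\<gamma> has_derivative (\<lambda>h. h *s (\<chi> j. d j))) (at t)"
      by (rule has_derivative_vecI) (use d in \<open>simp add: has_field_derivative_def mult_commute_abs\<close>)
    obtain L where L: "(f has_derivative L) (at (\<gamma> t))" "\<And>c x. L (c *s x) = c *s L x"
      using assms t sub unfolding holo_on_def by blast
    have "((\<lambda>t. f (\<gamma> t) $ k) has_derivative (\<lambda>h. L (h *s (\<chi> j. d j)) $ k)) (at t)"
      by (rule bounded_linear.has_derivative[OF bounded_linear_vec_nth has_derivative_compose[OF \<gamma> L(1)]])
    then show ?thesis
      unfolding has_field_derivative_def L(2)
      by (intro exI[of _ "L (\<chi> j. d j) $ k"]) (simp add: mult_commute_abs)
  qed
  then show "(\<lambda>t. f (\<gamma> t) $ k) holomorphic_on S"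
    by (simp add: holomorphic_on_open[OF \<open>open S\<close>])
qed

lemma holo_along_line:
  assumes "holo_along_curves h UNIV"
  shows "(\<lambda>t. h (a + t *s b)) holomorphic_on UNIV"
  by (rule holo_along_curvesD[OF assms]) (simp_all, intro holomorphic_intros)

section \<open>Squared norms along lines and the geometry of the domain\<close>

lemma cmod_sum_squares_add:
  fixes a b :: "'i \<Rightarrow> complex"
  shows "(\<Sum>i\<in>I. (cmod (a i + t * b i))\<^sup>2)
    = (\<Sum>i\<in>I. (cmod (a i))\<^sup>2) + 2 * Re (t * (\<Sum>i\<in>I. cnj (a i) * b i)) + (cmod t)\<^sup>2 * (\<Sum>i\<in>I. (cmod (b i))\<^sup>2)"
proof -
  have "(cmod (a i + t * b i))\<^sup>2
      = (cmod (a i))\<^sup>2 + 2 * Re (t * (cnj (a i) * b i)) + (cmod t)\<^sup>2 * (cmod (b i))\<^sup>2" for i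
    unfolding cmod_power2 by (simp add: power2_eq_square algebra_simps)
  then show ?thesis
    by (simp add: sum.distrib sum_distrib_left)
qed

lemma continuous_on_herm_form: "continuous_on UNIV herm_form"
  unfolding herm_form_def by (intro continuous_intros)

lemma open_Dn1: "open Dn1"
  unfolding Dn1_def by (rule open_Collect_less[OF continuous_on_const continuous_on_herm_form])

lemma Dn1_coordI:
  assumes "cmod (z $ None) < cmod (z $ Some i)"
  shows "z \<in> Dn1"
proof -
  have "(cmod (z $ None))\<^sup>2 < (cmod (z $ Some i))\<^sup>2"
    using assms by (intro power_strict_mono) auto
  also have "\<dots> \<le> (\<Sum>i\<in>UNIV. (cmod (z $ Some i))\<^sup>2)"
    by (rule member_le_sum) auto
  finally show ?thesis by (simp add: Dn1_def herm_form_def)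
qed

definition upd_coord :: "'a ^ 'm \<Rightarrow> 'm \<Rightarrow> 'a \<Rightarrow> 'a ^ 'm" where
  "upd_coord z j u = (\<chi> k. if k = j then u else z $ k)"

lemma upd_coord_nth [simp]: "upd_coord z j u $ k = (if k = j then u else z $ k)"
  by (simp add: upd_coord_def)

lemma upd_coord_holomorphic:
  assumes "\<And>k. (\<lambda>t. \<gamma> t $ k) holomorphic_on S" "\<delta> holomorphic_on S"
  shows "(\<lambda>t. upd_coord (\<gamma> t) j (\<delta> t) $ k) holomorphic_on S"
  using assms by (cases "k = j") simp_all

text \<open>Moving orthogonally to \<open>(z_1, ..., z_n)\<close> with \<open>z_0\<close> fixed adds
  only a nonnegative term to the form, so the line stays in the domain. Since \<open>z_j\<close>
  varies along it, its far part satisfies \<open>|z_j| > |z_0|\<close>.\<close>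

lemma Dn1_orthogonal_line:
  fixes z :: "complex ^ ('n::finite option)"
  assumes z: "z \<in> Dn1" and j: "cmod (z $ Some j) \<le> cmod (z $ None)"
  obtains u where "u $ None = 0" "u $ Some j \<noteq> 0" "\<And>t. z + t *s u \<in> Dn1"
proof -
  define W where "W = (\<Sum>m\<in>UNIV. (cmod (z $ Some m))\<^sup>2)"
  \<comment> \<open>Up to the factor \<open>W\<close>, this is the component of the
    \<open>j\<close>-th unit vector orthogonal to \<open>(z_1, ..., z_n)\<close>. Its
    \<open>j\<close>-th coordinate \<open>W - |z_j|^2\<close> is positive, as
    \<open>W > |z_0|^2 >= |z_j|^2\<close>.\<close>
  define u :: "complex ^ 'n option" where
    "u = (\<chi> k. case k of None \<Rightarrow> 0
       | Some m \<Rightarrow> (if m = j then of_real W else 0) - cnj (z $ Some j) * z $ Some m)"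
  have orth: "(\<Sum>m\<in>UNIV. cnj (z $ Some m) * u $ Some m) = 0"
  proof -
    have "(\<Sum>m\<in>UNIV. cnj (z $ Some m) * u $ Some m)
        = (\<Sum>m\<in>UNIV. (if m = j then cnj (z $ Some j) * of_real W else 0)
             - cnj (z $ Some j) * of_real ((cmod (z $ Some m))\<^sup>2))"
      by (rule sum.cong) (auto simp: u_def algebra_simps complex_norm_square simp del: of_real_power)
    also have "\<dots> = 0"
      unfolding sum_subtractf by (simp add: W_def flip: sum_distrib_left)
    finally show ?thesis .
  qed
  have "herm_form (z + t *s u) = herm_form z + (cmod t)\<^sup>2 * (\<Sum>m\<in>UNIV. (cmod (u $ Some m))\<^sup>2)" for t
    unfolding herm_form_def using cmod_sum_squares_add[of "\<lambda>m. z $ Some m" t "\<lambda>m. u $ Some m" UNIV]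
    by (simp add: orth) (simp add: u_def)
  then have "z + t *s u \<in> Dn1" for t
    using z unfolding Dn1_def by (simp add: add_pos_nonneg sum_nonneg)
  moreover have "u $ Some j \<noteq> 0"
  proof
    assume "u $ Some j = 0"
    then have "complex_of_real W = of_real ((cmod (z $ Some j))\<^sup>2)"
      by (simp add: u_def complex_norm_square mult.commute del: of_real_power)
    then have "W = (cmod (z $ Some j))\<^sup>2"
      by (simp only: of_real_eq_iff)
    moreover have "(cmod (z $ Some j))\<^sup>2 \<le> (cmod (z $ None))\<^sup>2"
      using j by (simp add: power_mono)
    moreover have "W > (cmod (z $ None))\<^sup>2"
      using z by (simp add: W_def Dn1_def herm_form_def)
    ultimately show False by linarith
  qed
  moreover have "u $ None = 0"
    by (simp add: u_def)
  ultimately show ?thesis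
    using that by blast
qed

text \<open>Hartogs extension: where \<open>|z_j| > |z_0|\<close> the whole \<open>z_i\<close>-disc lies in the domain, so
  Cauchy's formula over the large circle \<open>|z_i| = R\<close> returns the function itself; the
  Cauchy integral makes sense for all \<open>z\<close>.\<close>

lemma hartogs_extension:
  fixes h :: "complex ^ ('n::finite option) \<Rightarrow> complex"
  assumes cont: "continuous_on Dn1 h" and holo: "holo_along_curves h Dn1" and ij: "i \<noteq> (j::'n)"
  obtains H where "holo_along_curves H UNIV" "\<And>z. z \<in> Dn1 \<Longrightarrow> H z = h z"
proof -
  define E where "E R z = contour_integral (circlepath 0 R)
      (\<lambda>u. h (upd_coord z (Some i) u) / (u - z $ Some i)) / (2 * of_real pi * \<i>)" for R z
  \<comment> \<open>The first inequality puts the circle of integration inside the domain, the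
    second puts \<open>z_i\<close> inside the circle.\<close>
  define ok where "ok R z \<longleftrightarrow> cmod (z $ None) < R \<and> cmod (z $ Some i) < R" for R and z :: "complex ^ 'n option"
  have E_holo: "(\<lambda>t. E R (\<gamma> t)) holomorphic_on S"
    if "open S" and \<gamma>: "\<And>k. (\<lambda>t. \<gamma> t $ k) holomorphic_on S" and ok: "\<And>t. t \<in> S \<Longrightarrow> ok R (\<gamma> t)"
    for R S \<gamma>
  proof (cases "S = {}")
    case False
    then have "R > 0"
      using ok norm_ge_zero order_le_less_trans unfolding ok_def by blast
    have in_D: "upd_coord (\<gamma> t) (Some i) u \<in> Dn1" and ne: "u \<noteq> \<gamma> t $ Some i"
      if "t \<in> S" "u \<in> sphere 0 R" for t u
      using ok[OF that(1)] that(2) by (auto simp: ok_def intro: Dn1_coordI[of _ i])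
    have \<gamma>c: "continuous_on (S \<times> sphere 0 R) (\<lambda>x. \<gamma> (fst x) $ k)" for k
      by (rule continuous_on_compose2[OF holomorphic_on_imp_continuous_on[OF \<gamma>]])
         (auto intro: continuous_intros)
    have upd_cont: "continuous_on (S \<times> sphere 0 R) (\<lambda>x. upd_coord (\<gamma> (fst x)) (Some i) (snd x))"
      unfolding upd_coord_def
    proof (rule continuous_on_vec_lambda)
      show "continuous_on (S \<times> sphere 0 R) (\<lambda>x. if k = Some i then snd x else \<gamma> (fst x) $ k)" for k
        using \<gamma>c[of k] by (cases "k = Some i") (auto intro: continuous_intros)
    qed
    have "(\<lambda>t. contour_integral (circlepath 0 R)
        (\<lambda>u. h (upd_coord (\<gamma> t) (Some i) u) / (u - \<gamma> t $ Some i))) holomorphic_on S"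
    proof (rule contour_integral_circlepath_param_holomorphic[OF \<open>open S\<close> \<open>R > 0\<close>])
      show "continuous_on (S \<times> sphere 0 R)
          (\<lambda>(t, u). h (upd_coord (\<gamma> t) (Some i) u) / (u - \<gamma> t $ Some i))"
        unfolding case_prod_unfold
        by (intro continuous_on_divide continuous_on_diff continuous_on_compose2[OF cont upd_cont] \<gamma>c
              continuous_on_snd continuous_on_id)
           (use in_D ne in \<open>simp_all add: image_subset_iff\<close>)
      show "(\<lambda>t. h (upd_coord (\<gamma> t) (Some i) u) / (u - \<gamma> t $ Some i)) holomorphic_on S"
        if "u \<in> sphere 0 R" for u
        by (intro holomorphic_on_divide holomorphic_on_diff holomorphic_on_const \<gamma>
              holo_along_curvesD[OF holo \<open>open S\<close>] upd_coord_holomorphic)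
           (use in_D ne that in auto)
    qed
    then show ?thesis
      unfolding E_def by (intro holomorphic_intros) auto
  qed (simp add: holomorphic_on_def)
  have E_eq: "E R z = h z" if "cmod (z $ None) < cmod (z $ Some j)" "ok R z" for R z
  proof -
    have hol: "(\<lambda>u. h (upd_coord z (Some i) u)) holomorphic_on UNIV"
      by (intro holo_along_curvesD[OF holo] upd_coord_holomorphic)
         (use that ij in \<open>auto intro: Dn1_coordI[of _ j]\<close>)
    have "((\<lambda>u. h (upd_coord z (Some i) u) / (u - z $ Some i)) has_contour_integral
        2 * of_real pi * \<i> * h (upd_coord z (Some i) (z $ Some i))) (circlepath 0 R)"
      by (rule Cauchy_integral_circlepath_simple)
         (use that hol in \<open>auto simp: ok_def intro: holomorphic_on_subset\<close>)
    moreover have "upd_coord z (Some i) (z $ Some i) = z"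
      by (simp add: vec_eq_iff)
    ultimately show ?thesis
      by (simp add: E_def contour_integral_unique)
  qed
  \<comment> \<open>Both integrals are entire in the coordinate \<open>z_j\<close> and equal
    \<open>h\<close> once \<open>|z_j| > |z_0|\<close>, so they agree for every \<open>z_j\<close>.
    This makes gluing over different radii possible.\<close>
  have E_indep: "E R z = E R' z" if "ok R z" "ok R' z" for R R' z
  proof -
    have "E R (upd_coord z (Some j) t) = E R' (upd_coord z (Some j) t)" for t
    proof (rule entire_eq_if_eq_outside_disc[of "\<lambda>t. E R (upd_coord z (Some j) t)"
          "\<lambda>t. E R' (upd_coord z (Some j) t)" "cmod (z $ None)"])
      show "(\<lambda>t. E R (upd_coord z (Some j) t)) holomorphic_on UNIV"
        "(\<lambda>t. E R' (upd_coord z (Some j) t)) holomorphic_on UNIV"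
        by (intro E_holo upd_coord_holomorphic; use that ij in \<open>simp add: ok_def\<close>)+
      fix t assume "cmod (z $ None) < cmod t"
      then show "E R (upd_coord z (Some j) t) = E R' (upd_coord z (Some j) t)"
        using that ij by (simp add: E_eq ok_def)
    qed
    moreover have "upd_coord z (Some j) (z $ Some j) = z"
      by (simp add: vec_eq_iff)
    ultimately show ?thesis by metis
  qed
  define r where "r z = cmod (z $ None) + cmod (z $ Some i) + 1" for z :: "complex ^ 'n option"
  have ok_r: "ok (r z) z" for z
    unfolding ok_def r_def using norm_ge_zero[of "z $ None"] norm_ge_zero[of "z $ Some i"] by linarith
  define H where "H z = E (r z) z" for z
  have H_eq: "H z = E R z" if "ok R z" for R z
    unfolding H_def using E_indep ok_r that by blast
  have H_holo: "holo_along_curves H UNIV"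
    unfolding holo_along_curves_def
  proof (intro allI impI)
    fix S and \<gamma> :: "complex \<Rightarrow> complex ^ 'n option"
    assume "open S" and \<gamma>: "\<forall>j. (\<lambda>t. \<gamma> t $ j) holomorphic_on S"
    have "(\<lambda>t. H (\<gamma> t)) field_differentiable at s within S" if s: "s \<in> S" for s
    proof -
      \<comment> \<open>The radius in \<open>H\<close> varies with the point, but the radius chosen
        at \<open>s\<close> stays admissible nearby, where \<open>H\<close> is thus a single Cauchy
        integral.\<close>
      define R where "R = r (\<gamma> s)"
      define T where "T = {t \<in> S. cmod (\<gamma> t $ None) < R} \<inter> {t \<in> S. cmod (\<gamma> t $ Some i) < R}"
      have c: "continuous_on S (\<lambda>t. cmod (\<gamma> t $ k))" for k
        using \<gamma> by (intro continuous_intros holomorphic_on_imp_continuous_on) auto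
      have "open {t \<in> S. cmod (\<gamma> t $ k) < R}" for k
        using continuous_open_preimage[OF c \<open>open S\<close> open_lessThan, of k R]
        by (simp add: vimage_def Int_def conj_commute)
      then have "open T" unfolding T_def by blast
      have okT: "ok R (\<gamma> t)" if "t \<in> T" for t
        using that by (auto simp: T_def ok_def)
      have "s \<in> T"
        using ok_r[of "\<gamma> s"] s by (simp add: T_def R_def ok_def)
      have "(\<lambda>t. E R (\<gamma> t)) holomorphic_on T"
        by (rule E_holo[OF \<open>open T\<close>])
           (use \<gamma> okT in \<open>auto simp: T_def intro: holomorphic_on_subset\<close>)
      then have "(\<lambda>t. H (\<gamma> t)) holomorphic_on T"
        by (rule holomorphic_transform) (rule H_eq[OF okT, symmetric])
      then show ?thesis
        using \<open>open T\<close> \<open>s \<in> T\<close> field_differentiable_at_within holomorphic_on_imp_differentiable_at by blast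
    qed
    then show "(\<lambda>t. H (\<gamma> t)) holomorphic_on S"
      by (simp add: holomorphic_on_def)
  qed
  have H_eq1: "H z = h z" if "cmod (z $ None) < cmod (z $ Some j)" for z
    unfolding H_def using E_eq ok_r that by blast
  have "H z = h z" if z: "z \<in> Dn1" for z
  proof (cases "cmod (z $ None) < cmod (z $ Some j)")
    case False
    \<comment> \<open>Agreement is known only where \<open>|z_j| > |z_0|\<close>. The orthogonal
      line enters that region far out, and the identity theorem brings the agreement back to
      \<open>t = 0\<close>.\<close>
    then obtain u where u: "u $ None = 0" "u $ Some j \<noteq> 0" "\<And>t. z + t *s u \<in> Dn1"
      using Dn1_orthogonal_line[OF z, of j] by auto
    have "H (z + t *s u) = h (z + t *s u)" for t
    proof (rule entire_eq_if_eq_outside_disc[of "\<lambda>t. H (z + t *s u)" "\<lambda>t. h (z + t *s u)"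
          \<comment> \<open>Beyond this radius \<open>|t u_j| > |z_0| + |z_j|\<close>, so the
            reverse triangle inequality gives \<open>|z_j + t u_j| > |z_0|\<close>.\<close>
          "(cmod (z $ None) + cmod (z $ Some j)) / cmod (u $ Some j)"])
      show "(\<lambda>t. h (z + t *s u)) holomorphic_on UNIV"
        by (rule holo_along_curvesD[OF holo]) (simp_all add: u(3), intro holomorphic_intros)
      fix t assume "(cmod (z $ None) + cmod (z $ Some j)) / cmod (u $ Some j) < cmod t"
      then have "cmod (z $ None) + cmod (z $ Some j) < cmod (t * u $ Some j)"
        using u(2) by (simp add: norm_mult field_simps)
      then have "cmod (z $ None) < cmod (z $ Some j + t * u $ Some j)"
        using norm_diff_ineq[of "t * u $ Some j" "z $ Some j"] by (simp add: add.commute)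
      then show "H (z + t *s u) = h (z + t *s u)"
        by (intro H_eq1) (simp add: u(1))
    qed (rule holo_along_line[OF H_holo])
    from this[of 0] show ?thesis by simp
  qed (rule H_eq1)
  with H_holo that show ?thesis by blast
qed

subsection \<open>Similitudes of the Hermitian form\<close>

definition cdot :: "complex ^ 'm \<Rightarrow> complex ^ 'm \<Rightarrow> complex" where
  "cdot x y = (\<Sum>k\<in>UNIV. cnj (x $ k) * y $ k)"

lemma cdot_matrix_adjoint:
  "cdot (A *v x) y = cdot x (conj_transpose A *v y)"
proof -
  have "cdot (A *v x) y = (\<Sum>k\<in>UNIV. \<Sum>l\<in>UNIV. cnj (x $ l) * (cnj (A $ k $ l) * y $ k))"
    by (simp add: cdot_def matrix_vector_mult_def sum_distrib_right sum_distrib_left mult_ac)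
  also have "\<dots> = (\<Sum>l\<in>UNIV. \<Sum>k\<in>UNIV. cnj (x $ l) * (cnj (A $ k $ l) * y $ k))"
    by (rule sum.swap)
  finally show ?thesis
    by (simp add: cdot_def matrix_vector_mult_def conj_transpose_def sum_distrib_left)
qed

lemma cdot_axis_left: "cdot (axis i 1) y = y $ i"
proof -
  have "cnj (axis i 1 $ k) * y $ k = (if k = i then y $ k else 0)" for k
    by (simp add: axis_def)
  then show ?thesis by (simp add: cdot_def)
qed

definition herm_inner :: "complex ^ ('n::finite option) \<Rightarrow> complex ^ ('n option) \<Rightarrow> complex" where
  "herm_inner x y = cdot x (Jmat *v y)"

lemma sum_UNIV_option:
  fixes f :: "'n::finite option \<Rightarrow> 'b::comm_monoid_add"
  shows "(\<Sum>k\<in>UNIV. f k) = f None + (\<Sum>i\<in>UNIV. f (Some i))"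
  unfolding UNIV_option_conv by (subst sum.insert) (auto simp: sum.reindex)

lemma Jmat_mult_nth: "(Jmat *v y) $ k = (if k = None then - y $ k else y $ k)"
proof -
  have "Jmat $ k $ l * y $ l = (if l = k then if k = None then - y $ k else y $ k else 0)" for l
    by (auto simp: Jmat_def)
  then show ?thesis by (simp add: matrix_vector_mult_def)
qed

lemma herm_inner_expand:
  "herm_inner x y = - cnj (x $ None) * y $ None + (\<Sum>i\<in>UNIV. cnj (x $ Some i) * y $ Some i)"
  by (simp add: herm_inner_def cdot_def sum_UNIV_option Jmat_mult_nth)

lemma herm_inner_scale_left: "herm_inner (c *s x) y = cnj c * herm_inner x y"
  by (simp add: herm_inner_expand algebra_simps sum_distrib_left)

lemma herm_form_add:
  "herm_form (x + t *s y) = herm_form x + 2 * Re (t * herm_inner x y) + (cmod t)\<^sup>2 * herm_form y"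
proof -
  have "(cmod (x $ None + t * y $ None))\<^sup>2
      = (cmod (x $ None))\<^sup>2 + 2 * Re (t * (cnj (x $ None) * y $ None)) + (cmod t)\<^sup>2 * (cmod (y $ None))\<^sup>2"
    using cmod_sum_squares_add[of "\<lambda>_. x $ None" t "\<lambda>_. y $ None" "{()}"] by simp
  then show ?thesis
    using cmod_sum_squares_add[of "\<lambda>m. x $ Some m" t "\<lambda>m. y $ Some m" UNIV]
    by (simp add: herm_form_def herm_inner_expand algebra_simps)
qed

lemma herm_form_scale: "herm_form (c *s x) = (cmod c)\<^sup>2 * herm_form x"
  by (simp add: herm_form_def norm_mult power_mult_distrib sum_distrib_left algebra_simps)

lemma herm_form_zero [simp]: "herm_form 0 = 0"
  by (simp add: herm_form_def)

lemma herm_form_eq_herm_inner: "complex_of_real (herm_form x) = herm_inner x x"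
  by (simp add: herm_form_def herm_inner_expand complex_norm_square mult.commute del: of_real_power)

lemma herm_form_axis_None [simp]: "herm_form (axis None c) = - (cmod c)\<^sup>2"
  by (simp add: herm_form_def axis_def)

lemma herm_form_axis_Some [simp]: "herm_form (axis (Some i) c) = (cmod c)\<^sup>2"
proof -
  have "(cmod (axis (Some i) c $ Some j))\<^sup>2 = (if j = i then (cmod c)\<^sup>2 else 0)" for j
    by (simp add: axis_def)
  moreover have "axis (Some i) c $ None = 0"
    by (simp add: axis_def)
  ultimately show ?thesis by (simp add: herm_form_def)
qed

lemma matrix_vector_mult_axis_nth: "(A *v axis j 1) $ i = A $ i $ j"
  for A :: "'a::semiring_1 ^ 'm ^ 'n"
proof -
  have "A $ i $ k * axis j 1 $ k = (if k = j then A $ i $ j else 0)" for k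
    by (simp add: axis_def)
  then show ?thesis by (simp add: matrix_vector_mult_def)
qed

lemma matrix_herm_inner:
  "herm_inner (A *v x) (A *v y) = cdot x ((conj_transpose A ** Jmat ** A) *v y)"
  by (simp add: herm_inner_def cdot_matrix_adjoint matrix_vector_mul_assoc matrix_mul_assoc)

lemma matrix_vector_mult_add_scale: "A *v (x + t *s y) = A *v x + t *s (A *v y)"
  for A :: "'a::field ^ 'm ^ 'n"
  by (simp add: vector_scalar_commute matrix_vector_right_distrib)

text \<open>Polarisation: scaling the quadratic form by \<open>\<nu>\<close> scales the sesquilinear
  form, and testing on unit vectors yields the matrix identity.\<close>

lemma GU_iff:
  "A \<in> GU \<longleftrightarrow> invertible A \<and> (\<exists>\<nu>>0. \<forall>z. herm_form (A *v z) = \<nu> * herm_form z)"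
proof -
  have "conj_transpose A ** Jmat ** A = (\<chi> i j. complex_of_real \<nu> * Jmat $ i $ j)
      \<longleftrightarrow> (\<forall>z. herm_form (A *v z) = \<nu> * herm_form z)" (is "?M = ?N \<longleftrightarrow> ?R") for \<nu>
  proof
    have N: "?N *v y = of_real \<nu> *s (Jmat *v y)" for y
      by (simp add: vec_eq_iff matrix_vector_mult_def sum_distrib_left mult.assoc)
    have cdot_N: "cdot x (?N *v y) = of_real \<nu> * herm_inner x y" for x y
      unfolding N by (simp add: herm_inner_def cdot_def sum_distrib_left algebra_simps)
    {
      assume eq: "?M = ?N"
      have "complex_of_real (herm_form (A *v z)) = of_real (\<nu> * herm_form z)" for z
        unfolding herm_form_eq_herm_inner matrix_herm_inner eq cdot_N
        by (simp add: herm_form_eq_herm_inner)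
      then show ?R
        unfolding of_real_eq_iff by blast
    next
      assume ?R
      have re: "Re (t * herm_inner (A *v x) (A *v y)) = \<nu> * Re (t * herm_inner x y)" for t x y
      proof -
        have "herm_form (A *v x + t *s (A *v y)) = \<nu> * herm_form (x + t *s y)"
          using \<open>?R\<close> by (simp flip: matrix_vector_mult_add_scale)
        then show ?thesis
          using \<open>?R\<close> unfolding herm_form_add by (simp add: algebra_simps)
      qed
      have "cdot x (?M *v y) = cdot x (?N *v y)" for x y
        unfolding cdot_N matrix_herm_inner[symmetric]
        \<comment> \<open>\<open>t = 1\<close> recovers the real part and \<open>t = - \<i>\<close>
          the imaginary part.\<close>
        using re[of 1 x y] re[of "- \<i>" x y] by (simp add: complex_eq_iff)
      from this[of "axis _ 1" "axis _ 1"] have "?M $ i $ j = ?N $ i $ j" for i j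
        by (simp add: cdot_axis_left matrix_vector_mult_axis_nth)
      then show "?M = ?N" by (simp add: vec_eq_iff)
    }
  qed
  then show ?thesis
    unfolding GU_def by simp
qed

text \<open>The positive cone determines the form up to a factor: both forms vanish on the null cone
  of \<open>herm_form\<close>, in particular on all \<open>e_0 + c u\<close> with \<open>|c| = 1\<close> and \<open>u\<close> a unit vector orthogonal to \<open>e_0\<close>.\<close>

lemma matrix_preserving_Dn1_similitude:
  fixes A :: "complex ^ ('n::finite option) ^ ('n option)"
  assumes D: "\<And>z. A *v z \<in> Dn1 \<longleftrightarrow> z \<in> Dn1"
  shows "\<exists>\<nu>>0. \<forall>z. herm_form (A *v z) = \<nu> * herm_form z"
proof -
  define h where "h z = herm_form (A *v z)" for z
  note A_add = matrix_vector_mult_add_scale[of A]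
  have A_scale: "A *v (t *s y) = t *s (A *v y)" for y t
    by (simp add: vector_scalar_commute)
  have h_pos: "h z > 0 \<longleftrightarrow> herm_form z > 0" for z
    using D[of z] by (simp add: h_def Dn1_def)
  have null: "h z = 0" if "herm_form z = 0" for z
  proof (cases "z = 0")
    case True
    then show ?thesis by (simp add: h_def)
  next
    case False
    \<comment> \<open>Adding a positive multiple of \<open>w\<close> moves the null vector
      \<open>z\<close> into the positive cone. Letting the multiple tend to 0 gives
      \<open>h z >= 0\<close>, while \<open>h z > 0\<close> is excluded by
      \<open>h_pos\<close>.\<close>
    define w where "w = upd_coord z None 0"
    have "z $ None \<noteq> 0"
    proof
      assume 0: "z $ None = 0"
      with that have "(\<Sum>i\<in>UNIV. (cmod (z $ Some i))\<^sup>2) = 0"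
        by (simp add: herm_form_def)
      then have "z $ Some i = 0" for i
        by (simp add: sum_nonneg_eq_0_iff)
      with 0 have "z $ k = 0" for k by (cases k) auto
      with False show False by (simp add: vec_eq_iff)
    qed
    then have pos: "(\<Sum>i\<in>UNIV. (cmod (z $ Some i))\<^sup>2) > 0"
      using that by (simp add: herm_form_def)
    have w_pos: "herm_form w > 0"
      using pos by (simp add: w_def herm_form_def)
    have "herm_inner z w = of_real (herm_form w)"
      unfolding herm_form_eq_herm_inner by (simp add: w_def herm_inner_expand)
    then have "herm_form (z + of_real t *s w) > 0" if "t > 0" for t
      using w_pos that \<open>herm_form z = 0\<close> unfolding herm_form_add
      by (simp add: add_pos_pos)
    then have "h (z + of_real t *s w) > 0" if "t > 0" for t
      using h_pos that by metis
    moreover have "h (z + of_real t *s w)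
        = h z + 2 * t * Re (herm_inner (A *v z) (A *v w)) + t\<^sup>2 * h w" for t
      unfolding h_def A_add herm_form_add by simp
    ultimately have "h z + 2 * t * Re (herm_inner (A *v z) (A *v w)) + t\<^sup>2 * h w > 0" if "t > 0" for t
      using that by metis
    then have ev: "eventually (\<lambda>t. h z + 2 * t * Re (herm_inner (A *v z) (A *v w)) + t\<^sup>2 * h w \<ge> 0) (at_right 0)"
      by (intro eventually_mono[OF eventually_at_right_less[of 0]] less_imp_le)
    have "((\<lambda>t. h z + 2 * t * Re (herm_inner (A *v z) (A *v w)) + t\<^sup>2 * h w) \<longlongrightarrow>
        h z + 2 * 0 * Re (herm_inner (A *v z) (A *v w)) + 0\<^sup>2 * h w) (at_right 0)"
      by (intro tendsto_intros)
    from tendsto_lowerbound[OF this ev] have "h z \<ge> 0"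
      by simp
    moreover have "\<not> h z > 0"
      using h_pos that by simp
    ultimately show ?thesis by simp
  qed
  define e :: "complex ^ 'n option" where "e = axis None 1"
  have unit: "herm_inner (A *v e) (A *v u) = 0 \<and> h u = - h e"
    if u: "u $ None = 0" "herm_form u = 1" for u
  proof -
    let ?b = "herm_inner (A *v e) (A *v u)"
    have eu: "herm_inner e u = 0"
      using u(1) by (simp add: herm_inner_expand e_def axis_def)
    \<comment> \<open>All these \<open>e + t u\<close> are null. The choices \<open>1\<close>,
      \<open>-1\<close>, \<open>\<i>\<close>, \<open>-\<i>\<close> for \<open>t\<close> separate the
      cross term from \<open>h e + h u\<close>.\<close>
    have *: "h e + 2 * Re (t * ?b) + h u = 0" if "cmod t = 1" for t
    proof -
      have "herm_form (e + t *s u) = 0"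
        unfolding herm_form_add by (simp add: eu that u(2)) (simp add: e_def)
      then have "h (e + t *s u) = 0" by (rule null)
      then show ?thesis
        unfolding h_def A_add herm_form_add by (simp add: that)
    qed
    show ?thesis
      using *[of 1] *[of "-1"] *[of "\<i>"] *[of "-\<i>"] by (simp add: complex_eq_iff)
  qed
  obtain i :: 'n where True by simp
  have axis_i: "axis (Some i) 1 $ None = (0::complex)"
    by (simp add: axis_def)
  \<comment> \<open>Equals \<open>h\<close> at every unit vector orthogonal to \<open>e\<close>;
    such a vector lies in the positive cone, hence \<open>\<nu> > 0\<close>.\<close>
  define \<nu> where "\<nu> = - h e"
  have "h (axis (Some i) 1) > 0"
    unfolding h_pos by simp
  then have "\<nu> > 0"
    using unit[of "axis (Some i) 1"] axis_i by (simp add: \<nu>_def)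
  moreover have "h z = \<nu> * herm_form z" for z
  proof -
    define w where "w = upd_coord z None 0"
    define r where "r = sqrt (herm_form w)"
    have w0: "w $ None = 0" by (simp add: w_def)
    have w_nonneg: "herm_form w \<ge> 0"
      unfolding herm_form_def w0 by (simp add: sum_nonneg)
    have r2: "r\<^sup>2 = herm_form w"
      using w_nonneg by (simp add: r_def)
    have hz: "herm_form z = - (cmod (z $ None))\<^sup>2 + r\<^sup>2"
      unfolding r2 by (simp add: herm_form_def w_def)
    \<comment> \<open>Normalises the part of \<open>z\<close> orthogonal to \<open>e\<close>; if
      that part is 0, any unit vector orthogonal to \<open>e\<close> will do.\<close>
    obtain u where u: "u $ None = 0" "herm_form u = 1" "w = of_real r *s u"
    proof (cases "r = 0")
      case True
      then have "(\<Sum>i\<in>UNIV. (cmod (w $ Some i))\<^sup>2) = 0"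
        using r2 w0 by (simp add: herm_form_def)
      then have "w $ Some i = 0" for i
        by (simp add: sum_nonneg_eq_0_iff)
      with w0 have "w $ k = 0" for k by (cases k) auto
      with True show ?thesis
        by (intro that[of "axis (Some i) 1"]) (auto simp: vec_eq_iff axis_i)
    next
      case False
      show ?thesis
      proof (rule that[of "inverse (of_real r) *s w"])
        show "herm_form (inverse (of_real r) *s w) = 1"
          unfolding herm_form_scale using False
          by (simp add: norm_inverse power_inverse flip: r2)
      qed (use False w0 in \<open>auto simp: vec_eq_iff\<close>)
    qed
    have z: "z = z $ None *s e + of_real r *s u"
      unfolding u(3)[symmetric] by (auto simp: vec_eq_iff w_def e_def axis_def)
    have "h z = (cmod (z $ None))\<^sup>2 * h e + r\<^sup>2 * h u"
      by (subst z) (use unit[OF u(1,2)] in \<open>simp add: h_def A_add A_scale herm_form_add herm_form_scale herm_inner_scale_left\<close>)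
    then show ?thesis
      using unit[OF u(1,2)] by (simp add: hz \<nu>_def algebra_simps)
  qed
  ultimately show ?thesis
    unfolding h_def by blast
qed

subsection \<open>Linearity of automorphisms\<close>

lemma Dn1_scale: "c \<noteq> 0 \<Longrightarrow> c *s z \<in> Dn1 \<longleftrightarrow> z \<in> Dn1"
  by (simp add: Dn1_def herm_form_scale zero_less_mult_iff)

lemma zero_notin_Dn1: "0 \<notin> Dn1"
  by (simp add: Dn1_def)

lemma not_Dn1_coord_le:
  assumes "z \<notin> Dn1"
  shows "cmod (z $ k) \<le> cmod (z $ None)"
proof (cases k)
  case (Some i)
  then show ?thesis
    using assms Dn1_coordI[of z i] by force
qed simp

text \<open>Here \<open>n > 1\<close> enters: Hartogs extension, applied to each component, needs
  one coordinate to integrate over and another to guarantee membership in the domain.\<close>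

lemma holo_on_Dn1_extension:
  fixes f :: "complex ^ ('n::finite option) \<Rightarrow> complex ^ 'm"
  assumes card: "CARD('n) > 1" and f: "holo_on f Dn1"
  obtains F where "\<And>k. holo_along_curves (\<lambda>z. F z $ k) UNIV" "\<And>z. z \<in> Dn1 \<Longrightarrow> F z = f z"
proof -
  have "\<not> is_singleton (UNIV :: 'n set)"
    using card by (simp add: is_singleton_altdef)
  then obtain i j :: 'n where ij: "i \<noteq> j"
    by (metis UNIV_I UNIV_eq_I is_singletonI' empty_not_UNIV)
  have "\<exists>H. holo_along_curves H UNIV \<and> (\<forall>z\<in>Dn1. H z = f z $ k)" for k
  proof -
    have "continuous_on Dn1 (\<lambda>z. f z $ k)"
      using holo_on_imp_continuous_on[OF f] by (intro continuous_intros)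
    then obtain H where "holo_along_curves H UNIV" "\<And>z. z \<in> Dn1 \<Longrightarrow> H z = f z $ k"
      using hartogs_extension[OF _ holo_on_imp_holo_along_curves[OF f] ij] by blast
    then show ?thesis by blast
  qed
  then obtain H where H: "\<And>k. holo_along_curves (H k) UNIV" "\<And>k z. z \<in> Dn1 \<Longrightarrow> H k z = f z $ k"
    by metis
  show ?thesis
    by (rule that[of "\<lambda>z. \<chi> k. H k z"]) (simp_all add: H vec_eq_iff)
qed

text \<open>Every line in direction \<open>e_i\<close> with \<open>i >= 1\<close> lies in the domain
  far out, so the identity theorem extends the relation to all points.\<close>

lemma extension_left_inverse:
  fixes F G :: "complex ^ ('n::finite option) \<Rightarrow> complex ^ ('n option)"
  assumes F: "\<And>k. holo_along_curves (\<lambda>z. F z $ k) UNIV"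
    and G: "\<And>k. holo_along_curves (\<lambda>z. G z $ k) UNIV"
    and GF: "\<And>z. z \<in> Dn1 \<Longrightarrow> G (F z) = z"
  shows "G (F z) = z"
proof -
  obtain i :: 'n where True by simp
  define e :: "complex ^ 'n option" where "e = axis (Some i) 1"
  have "G (F (z + t *s e)) $ k = (z + t *s e) $ k" for t k
  proof (rule entire_eq_if_eq_outside_disc[of "\<lambda>t. G (F (z + t *s e)) $ k" "\<lambda>t. (z + t *s e) $ k"
        "cmod (z $ None) + cmod (z $ Some i)"])
    show "(\<lambda>t. G (F (z + t *s e)) $ k) holomorphic_on UNIV"
      by (rule holo_along_curvesD[OF G open_UNIV]) (auto intro: holo_along_line[OF F])
    show "(\<lambda>t. (z + t *s e) $ k) holomorphic_on UNIV"
      by (simp, intro holomorphic_intros)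
    fix t assume t: "cmod (z $ None) + cmod (z $ Some i) < cmod t"
    then have "cmod (z $ None) < cmod (z $ Some i + t)"
      using norm_diff_ineq[of t "z $ Some i"] by (simp add: add.commute)
    then have "z + t *s e \<in> Dn1"
      by (intro Dn1_coordI[of _ i]) (simp add: e_def axis_def)
    then show "G (F (z + t *s e)) $ k = (z + t *s e) $ k"
      by (simp add: GF)
  qed
  from this[of 0] show ?thesis
    by (simp add: vec_eq_iff)
qed

text \<open>On a line through the origin outside the domain, the zeroth coordinate of \<open>F\<close> dominates all the
  others, so by Liouville's theorem the line is mapped into a line.\<close>

lemma line_to_line:
  fixes F :: "complex ^ ('n::finite option) \<Rightarrow> complex ^ ('n option)"
  assumes F: "\<And>k. holo_along_curves (\<lambda>z. F z $ k) UNIV" and inj: "inj F"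
    and neg: "\<And>z. z \<notin> Dn1 \<Longrightarrow> F z \<notin> Dn1"
    and z: "z \<notin> Dn1" "z \<noteq> 0"
  obtains c where "\<And>t. F (t *s z) = F (t *s z) $ None *s c"
    and "inj (\<lambda>t. F (t *s z) $ None)"
proof -
  define p where "p t = F (t *s z) $ None" for t
  have hol: "(\<lambda>t. F (t *s z) $ k) holomorphic_on UNIV" for k
    using holo_along_line[OF F, where a = 0 and b = z] by simp
  have inj_line: "t = t'" if "F (t *s z) = F (t' *s z)" for t t'
  proof -
    have "t *s z = t' *s z" using inj that by (rule injD)
    with z(2) show ?thesis by (simp add: vec_eq_iff) (metis mult_cancel_right)
  qed
  have le: "cmod (F (t *s z) $ k) \<le> cmod (p t)" for t k
    unfolding p_def
  proof (intro not_Dn1_coord_le neg)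
    show "t *s z \<notin> Dn1"
      using z(1) Dn1_scale[of t z] by (cases "t = 0") (auto simp: zero_notin_Dn1)
  qed
  have zero: "F (t *s z) = 0" if "p t = 0" for t
    using le[of t] that by (simp add: vec_eq_iff)
  \<comment> \<open>A zero of \<open>p\<close> is a zero of \<open>F\<close> because
    \<open>p\<close> dominates all coordinates, and injectivity allows at most one.\<close>
  obtain s where s: "\<And>t. p t = 0 \<Longrightarrow> t = s"
    using zero inj_line by metis
  have "\<exists>a. \<forall>t. F (t *s z) $ k = a * p t" for k
    using entire_dominated_proportional[OF _ hol le s, of k] hol[of None] unfolding p_def by metis
  then obtain a where a: "\<And>t k. F (t *s z) $ k = a k * p t"
    by metis
  have eq: "F (t *s z) = p t *s (\<chi> k. a k)" for t
    by (simp add: vec_eq_iff a mult.commute)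
  have "inj p"
    by (rule injI) (metis eq inj_line)
  with eq show ?thesis
    unfolding p_def by (rule that)
qed

text \<open>The image line of any complex line through 0 outside the domain contains
  \<open>F 0\<close>. Were \<open>F 0\<close> nonzero, surjectivity would place the whole complement
  on the line spanned by \<open>F 0\<close>.\<close>

lemma fixes_origin:
  fixes F :: "complex ^ ('n::finite option) \<Rightarrow> complex ^ ('n option)"
  assumes F: "\<And>k. holo_along_curves (\<lambda>z. F z $ k) UNIV" and inj: "inj F"
    and neg: "\<And>z. z \<notin> Dn1 \<Longrightarrow> F z \<notin> Dn1"
    and onto: "\<And>y. y \<notin> Dn1 \<Longrightarrow> \<exists>z. z \<notin> Dn1 \<and> F z = y"
  shows "F 0 = 0"
proof (rule ccontr)
  assume F0: "F 0 \<noteq> 0"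
  have line: "\<exists>a. y = a *s F 0" if y: "y \<notin> Dn1" for y
  proof -
    obtain z where z: "z \<notin> Dn1" "F z = y"
      using onto[OF y] by blast
    show ?thesis
    proof (cases "z = 0")
      case True
      with z show ?thesis by (intro exI[of _ 1]) simp
    next
      case False
      then obtain c where c: "\<And>t. F (t *s z) = F (t *s z) $ None *s c"
        using line_to_line[OF F inj neg z(1)] by metis
      have c0: "F 0 = F 0 $ None *s c"
        using c[of 0] by simp
      then have ne: "F 0 $ None \<noteq> 0"
        using F0 by (metis vector_smult_lzero)
      have "y = y $ None *s c"
        using c[of 1] z(2) by simp
      also have "c = inverse (F 0 $ None) *s F 0"
        using ne by (subst c0) (simp add: vec_eq_iff)
      finally show ?thesis
        by (metis vector_smult_assoc)
    qed
  qed
  obtain i :: 'n where True by simp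
  \<comment> \<open>The form is -1 at \<open>?e\<close> and 0 at \<open>?e + ?e'\<close>: two
    independent vectors outside the domain.\<close>
  let ?e = "axis None 1 :: complex ^ 'n option" and ?e' = "axis (Some i) 1 :: complex ^ 'n option"
  have inner: "herm_inner ?e ?e' = 0"
    by (simp add: herm_inner_expand axis_def)
  have "?e \<notin> Dn1" "?e + 1 *s ?e' \<notin> Dn1"
    unfolding Dn1_def mem_Collect_eq herm_form_add by (simp_all add: inner)
  then obtain a b where a: "?e = a *s F 0" and b: "?e + 1 *s ?e' = b *s F 0"
    using line by metis
  have "a * F 0 $ None = 1" "a * F 0 $ Some i = 0" "b * F 0 $ Some i = 1"
    using arg_cong[OF a, of "\<lambda>v. v $ None"] arg_cong[OF a, of "\<lambda>v. v $ Some i"]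
      arg_cong[OF b, of "\<lambda>v. v $ Some i"] by (simp_all add: axis_def)
  then show False by auto
qed

text \<open>The line goes into a line, and its zeroth coordinate is an injective entire function
  vanishing at 0, hence a multiple of \<open>t\<close>.\<close>

lemma homogeneous_on_complement:
  fixes F :: "complex ^ ('n::finite option) \<Rightarrow> complex ^ ('n option)"
  assumes F: "\<And>k. holo_along_curves (\<lambda>z. F z $ k) UNIV" and inj: "inj F"
    and neg: "\<And>z. z \<notin> Dn1 \<Longrightarrow> F z \<notin> Dn1"
    and F0: "F 0 = 0" and z: "z \<notin> Dn1"
  shows "F (t *s z) = t *s F z"
proof (cases "z = 0")
  case False
  then obtain c where c: "\<And>t. F (t *s z) = F (t *s z) $ None *s c"
    and inj': "inj (\<lambda>t. F (t *s z) $ None)"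
    using line_to_line[OF F inj neg z] by metis
  have "(\<lambda>t. F (t *s z) $ None) holomorphic_on UNIV"
    using holo_along_line[OF F, where a = 0 and b = z] by simp
  then obtain a where a: "\<And>t. F (t *s z) $ None = a * t"
    using entire_injective_linear[OF _ inj'] F0 by auto
  have eq: "F (t *s z) = (a * t) *s c" for t
    using c[of t] a[of t] by simp
  from eq[of t] eq[of 1] show ?thesis
    by (simp add: vec_eq_iff mult_ac)
qed (simp add: F0)

text \<open>A line in direction \<open>e_0\<close> leaves the domain far out, so for fixed
  \<open>c\<close> the identity theorem spreads homogeneity from the complement.\<close>

lemma homogeneous_everywhere:
  fixes F :: "complex ^ ('n::finite option) \<Rightarrow> complex ^ ('n option)"
  assumes F: "\<And>k. holo_along_curves (\<lambda>z. F z $ k) UNIV"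
    and hom: "\<And>z t. z \<notin> Dn1 \<Longrightarrow> F (t *s z) = t *s F z"
  shows "F (c *s z) = c *s F z"
proof -
  define e :: "complex ^ 'n option" where "e = axis None 1"
  \<comment> \<open>For \<open>|t| > B\<close> the modulus \<open>|z_0 + t|\<close> is at least the
    norm of the other coordinates, which makes the form nonpositive.\<close>
  define B where "B = cmod (z $ None) + sqrt (\<Sum>i\<in>UNIV. (cmod (z $ Some i))\<^sup>2)"
  have "F (c *s (z + t *s e)) $ k = c * F (z + t *s e) $ k" for t k
  proof (rule entire_eq_if_eq_outside_disc[of "\<lambda>t. F (c *s (z + t *s e)) $ k"
        "\<lambda>t. c * F (z + t *s e) $ k" B])
    have "(\<lambda>t. F (c *s z + t *s (c *s e)) $ k) holomorphic_on UNIV"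
      by (rule holo_along_line[OF F])
    moreover have "c *s (z + t *s e) = c *s z + t *s (c *s e)" for t
      by (simp add: vec_eq_iff algebra_simps)
    ultimately show "(\<lambda>t. F (c *s (z + t *s e)) $ k) holomorphic_on UNIV"
      by (simp only:)
    show "(\<lambda>t. c * F (z + t *s e) $ k) holomorphic_on UNIV"
      by (intro holomorphic_intros holo_along_line[OF F])
    fix t assume "B < cmod t"
    then have "sqrt (\<Sum>i\<in>UNIV. (cmod (z $ Some i))\<^sup>2) \<le> cmod (z $ None + t)"
      using norm_diff_ineq[of t "z $ None"] by (simp add: B_def add.commute)
    then have "(\<Sum>i\<in>UNIV. (cmod (z $ Some i))\<^sup>2) \<le> (cmod (z $ None + t))\<^sup>2"
      by (rule sqrt_le_D)
    then have "z + t *s e \<notin> Dn1"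
      by (simp add: Dn1_def herm_form_def e_def axis_def)
    then show "F (c *s (z + t *s e)) $ k = c * F (z + t *s e) $ k"
      using hom[of "z + t *s e" c] by (metis vector_smult_component)
  qed
  from this[of 0] show ?thesis
    by (simp add: vec_eq_iff)
qed

text \<open>Homogeneity gives \<open>F (z + t v) = t F (v + z / t)\<close>, which grows at most
  linearly in \<open>t\<close>. By Liouville's theorem it is affine in \<open>t\<close>, with
  constant term \<open>F z\<close> and slope \<open>F v\<close>.\<close>

lemma homogeneous_imp_additive:
  fixes F :: "complex ^ 'm \<Rightarrow> complex ^ 'm"
  assumes F: "\<And>k. holo_along_curves (\<lambda>z. F z $ k) UNIV"
    and hom: "\<And>c z. F (c *s z) = c *s F z"
  shows "F (z + v) = F z + F v"
proof -
  have "F (z + v) $ k = F z $ k + F v $ k" for k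
  proof -
    define p where "p t = F (z + t *s v) $ k" for t
    define q where "q s = F (v + s *s z) $ k" for s
    have holp: "p holomorphic_on UNIV" and holq: "q holomorphic_on UNIV"
      unfolding p_def[abs_def] q_def[abs_def] by (rule holo_along_line[OF F])+
    have pq: "p t = t * q (inverse t)" if "t \<noteq> 0" for t
    proof -
      have eq: "z + t *s v = t *s (v + inverse t *s z)"
        using that by (simp add: vec_eq_iff algebra_simps)
      show ?thesis
        by (simp only: p_def q_def eq hom vector_smult_component)
    qed
    have "compact (q ` cball 0 1)"
      using holq by (intro compact_continuous_image)
        (auto intro: holomorphic_on_imp_continuous_on holomorphic_on_subset)
    then obtain M where "\<forall>x\<in>q ` cball 0 1. cmod x \<le> M"
      using compact_imp_bounded bounded_iff by metis
    then have M: "cmod (q s) \<le> M" if "cmod s \<le> 1" for s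
      using that by simp
    have bound: "cmod (p t) \<le> M * cmod t ^ 1" if t: "1 \<le> cmod t" for t
    proof -
      have "t \<noteq> 0" using t by auto
      moreover have "cmod (q (inverse t)) \<le> M"
        using t by (intro M) (simp add: norm_inverse inverse_le_1_iff)
      ultimately show ?thesis
        by (simp add: pq norm_mult mult.commute mult_right_mono)
    qed
    define b where "b = deriv p 0"
    have p_eq: "p t = p 0 + b * t" for t
      using Liouville_polynomial[OF holp bound, where \<xi> = t] by (simp add: b_def)
    \<comment> \<open>Identifies the slope \<open>b\<close> with \<open>F v $ k\<close>: the formula
      for \<open>q s\<close>, valid for nonzero \<open>s\<close>, extends to
      \<open>s = 0\<close>.\<close>
    have "q 0 = p 0 * 0 + b"
    proof (rule entire_eq_if_eq_outside_disc[OF holq, of "\<lambda>s. p 0 * s + b" 0])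
      fix s :: complex assume "0 < cmod s"
      then have "s \<noteq> 0" by simp
      then have "q s = s * p (inverse s)"
        using pq[of "inverse s"] by simp
      also have "\<dots> = p 0 * s + b"
        using \<open>s \<noteq> 0\<close> by (subst p_eq) (simp add: field_simps)
      finally show "q s = p 0 * s + b" .
    qed (intro holomorphic_intros)
    with p_eq[of 1] show ?thesis
      by (simp add: p_def q_def)
  qed
  then show ?thesis by (simp add: vec_eq_iff)
qed

section \<open>The two directions of the characterisation\<close>

lemma GU_imp_biholo_self:
  fixes f :: "complex ^ ('n::finite option) \<Rightarrow> complex ^ ('n option)"
  assumes A: "A \<in> GU" and f: "\<And>z. z \<in> Dn1 \<Longrightarrow> f z = A *v z"
  shows "biholo_self f Dn1"
proof -
  obtain \<nu> where inv: "invertible A" and \<nu>: "\<nu> > 0" "\<And>z. herm_form (A *v z) = \<nu> * herm_form z"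
    using A unfolding GU_iff by blast
  obtain B where B: "A ** B = mat 1" "B ** A = mat 1"
    using inv unfolding invertible_def by blast
  have AB: "A *v (B *v z) = z" and BA: "B *v (A *v z) = z" for z
    by (simp_all add: matrix_vector_mul_assoc B)
  \<comment> \<open>A map agreeing with a matrix only on \<open>Dn1\<close> still has its derivative
    there, since \<open>Dn1\<close> is open.\<close>
  have holo: "holo_on g Dn1" if g: "\<And>z. z \<in> Dn1 \<Longrightarrow> g z = M *v z"
    for g and M :: "complex ^ 'n option ^ 'n option"
    unfolding holo_on_def
  proof
    fix z :: "complex ^ 'n option" assume z: "z \<in> Dn1"
    have "((*v) M has_derivative (*v) M) (at z)"
      by (rule bounded_linear_imp_has_derivative) simp
    then have "(g has_derivative (*v) M) (at z)"
      by (rule has_derivative_transform_within_open[OF _ open_Dn1 z]) (simp add: g)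
    then show "\<exists>L. (g has_derivative L) (at z) \<and> (\<forall>c x. L (c *s x) = c *s L x)"
      by (intro exI[of _ "(*v) M"]) (simp add: vector_scalar_commute)
  qed
  have A_D: "A *v z \<in> Dn1 \<longleftrightarrow> z \<in> Dn1" for z
    using \<nu> by (simp add: Dn1_def zero_less_mult_iff)
  have B_D: "B *v z \<in> Dn1 \<longleftrightarrow> z \<in> Dn1" for z
    using A_D[of "B *v z"] by (simp add: AB)
  show ?thesis
    unfolding biholo_self_def
  proof (intro conjI exI[of _ "(*v) B"] ballI)
    show "holo_on f Dn1" by (rule holo) (rule f)
    show "holo_on ((*v) B) Dn1" by (rule holo) simp
    show "f ` Dn1 \<subseteq> Dn1" using f A_D by auto
    show "(*v) B ` Dn1 \<subseteq> Dn1" using B_D by auto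
  qed (simp_all add: f B_D AB BA)
qed

lemma biholo_self_imp_GU:
  fixes f :: "complex ^ ('n::finite option) \<Rightarrow> complex ^ ('n option)"
  assumes card: "CARD('n) > 1" and f: "biholo_self f Dn1"
  shows "\<exists>A\<in>GU. \<forall>z\<in>Dn1. f z = A *v z"
proof -
  obtain g where hf: "holo_on f Dn1" "f ` Dn1 \<subseteq> Dn1" and hg: "holo_on g Dn1" "g ` Dn1 \<subseteq> Dn1"
    and gf: "\<And>z. z \<in> Dn1 \<Longrightarrow> g (f z) = z" and fg: "\<And>z. z \<in> Dn1 \<Longrightarrow> f (g z) = z"
    using f unfolding biholo_self_def by blast
  obtain F where F: "\<And>k. holo_along_curves (\<lambda>z. F z $ k) UNIV" and Ff: "\<And>z. z \<in> Dn1 \<Longrightarrow> F z = f z"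
    using holo_on_Dn1_extension[OF card hf(1)] by blast
  obtain G where G: "\<And>k. holo_along_curves (\<lambda>z. G z $ k) UNIV" and Gg: "\<And>z. z \<in> Dn1 \<Longrightarrow> G z = g z"
    using holo_on_Dn1_extension[OF card hg(1)] by blast
  have fD: "f z \<in> Dn1" and gD: "g z \<in> Dn1" if "z \<in> Dn1" for z
    using hf(2) hg(2) that by auto
  have GF: "G (F z) = z" for z
    by (rule extension_left_inverse[OF F G]) (simp add: Ff Gg fD gf)
  have FG: "F (G z) = z" for z
    by (rule extension_left_inverse[OF G F]) (simp add: Ff Gg gD fg)
  \<comment> \<open>If \<open>F z\<close> were in the domain, then
    \<open>z = G (F z) = g (F z)\<close> would be too.\<close>
  have F_neg: "F z \<notin> Dn1" if "z \<notin> Dn1" for z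
    using that GF[of z] Gg gD by metis
  have G_neg: "G z \<notin> Dn1" if "z \<notin> Dn1" for z
    using that FG[of z] Ff fD by metis
  have inj: "inj F"
    by (metis GF injI)
  have F0: "F 0 = 0"
    by (rule fixes_origin[OF F inj F_neg]) (use FG G_neg in blast)+
  have hom: "F (c *s z) = c *s F z" for c z
    by (rule homogeneous_everywhere[OF F homogeneous_on_complement[OF F inj F_neg F0]])
  have add: "F (z + v) = F z + F v" for z v
    by (rule homogeneous_imp_additive[OF F hom])
  have lin: "Vector_Spaces.linear (*s) (*s) F"
    by unfold_locales (simp_all add: add hom)
  define A where "A = matrix F"
  have A: "A *v z = F z" for z
    unfolding A_def by (rule matrix_works[OF lin])
  have "inj ((*v) A)"
    using inj by (simp add: inj_def A)
  then have "invertible A"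
    unfolding invertible_left_inverse matrix_left_invertible_injective .
  moreover have "A *v z \<in> Dn1 \<longleftrightarrow> z \<in> Dn1" for z
    using F_neg[of z] Ff[of z] fD[of z] by (auto simp: A)
  ultimately have "A \<in> GU"
    unfolding GU_iff using matrix_preserving_Dn1_similitude by blast
  moreover have "f z = A *v z" if "z \<in> Dn1" for z
    using Ff that by (simp add: A)
  ultimately show ?thesis by blast
qed

theorem theorem3p1:
  fixes f :: "complex ^ ('n::finite option) \<Rightarrow> complex ^ ('n option)"
  assumes "CARD('n) > 1"
  shows "biholo_self f Dn1 \<longleftrightarrow> (\<exists>A\<in>GU. \<forall>z\<in>Dn1. f z = A *v z)"
  using biholo_self_imp_GU[OF assms] GU_imp_biholo_self by blast

end
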